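(* Let $n\ge1$. For any permutation $\sigma\in S_n$, $$\sum_{p\in\varphi^{-1}(\sigma)} q^{\mathtt{area}(p)}=\prod_{i=1}^n [\ell(i;\sigma)]_q.$$
   Context: Write $[n]=\{1,\dots,n\}$. A street has parking spots $1,\dots,n$ in order, and cars $c_1,\dots,c_n$ arrive in this order. Given $\alpha=(a_1,\dots,a_n)\in[n]^n$, car $c_i$ drives to its preferred spot $a_i$ and parks there if it is empty; otherwise it continues forward and parks in the first empty spot after $a_i$, if there is one (otherwise it fails to park). The tuple $\alpha$ is a parking function of length $n$ if all $n$ cars park; $PF_n$ is the set of parking functions of length $n$. The map $\varphi:PF_n\to S_n$ sends $\alpha$ to the permutation $s_1s_2\cdots s_n$ (one-line notation), where spot $i$ is occupied by car $c_{s_i}$ after all cars have parked; $\varphi^{-1}(\sigma)\subseteq PF_n$ is the fiber. For $\sigma=s_1\cdots s_n\in S_n$ and $1\le i\le n$, $\ell(i;\sigma)$ is the length of the longest subsequence $s_j\cdots s_i$ of consecutive entries of $\sigma$ such that $s_t\le s_i$ for all $j\le t\le i$. For a parking function $\alpha=(a_1,\dots,a_n)\in PF_n$, $\mathtt{area}(\alpha)=\sum_{i=1}^n (n-i-a_i+1)$. For a positive integer $m$, $[m]_q=1+q+q^2+\cdots+q^{m-1}$, where $q$ is an indeterminate. *)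

theory Defs
  imports "HOL-Combinatorics.Permutations" "HOL-Computational_Algebra.Polynomial"
begin

text \<open>
  Tuples in \<open>[n]^n\<close> are extensional functions \<open>\<alpha> \<in> {1..n} \<rightarrow>\<^sub>E {1..n}\<close>; outside \<open>{1..n}\<close> they are
  \<open>undefined\<close>, so each tuple is represented by exactly one function.
  The state of the street is a partial map from spots to the cars parked there.
\<close>

text \<open>A car that finds no empty spot from \<open>a\<close> onwards leaves the street unchanged.\<close>

definition park_car :: "nat \<Rightarrow> nat \<Rightarrow> nat \<Rightarrow> (nat \<rightharpoonup> nat) \<Rightarrow> (nat \<rightharpoonup> nat)" where
  "park_car n c a occ =
     (let E = {s \<in> {a..n}. occ s = None} in if E = {} then occ else occ(Min E \<mapsto> c))"

primrec park :: "nat \<Rightarrow> (nat \<Rightarrow> nat) \<Rightarrow> nat \<Rightarrow> (nat \<rightharpoonup> nat)" where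
  "park n \<alpha> 0 = Map.empty"
| "park n \<alpha> (Suc k) = park_car n (Suc k) (\<alpha> (Suc k)) (park n \<alpha> k)"

definition parking_functions :: "nat \<Rightarrow> (nat \<Rightarrow> nat) set" where
  "parking_functions n =
     {\<alpha> \<in> {1..n} \<rightarrow>\<^sub>E {1..n}. \<forall>c\<in>{1..n}. \<exists>s\<in>{1..n}. park n \<alpha> n s = Some c}"

text \<open>The map \<open>\<phi>\<close>, extended by the identity outside \<open>{1..n}\<close> as \<open>permutes\<close> requires.\<close>

definition outcome :: "nat \<Rightarrow> (nat \<Rightarrow> nat) \<Rightarrow> (nat \<Rightarrow> nat)" where
  "outcome n \<alpha> = (\<lambda>s. if s \<in> {1..n} then the (park n \<alpha> n s) else s)"

definition fiber :: "nat \<Rightarrow> (nat \<Rightarrow> nat) \<Rightarrow> (nat \<Rightarrow> nat) set" where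
  "fiber n \<sigma> = {\<alpha> \<in> parking_functions n. outcome n \<alpha> = \<sigma>}"

definition ell :: "nat \<Rightarrow> (nat \<Rightarrow> nat) \<Rightarrow> nat" where
  "ell i \<sigma> = Max {i - j + 1 | j. 1 \<le> j \<and> j \<le> i \<and> (\<forall>t\<in>{j..i}. \<sigma> t \<le> \<sigma> i)}"

text \<open>Individual summands can be negative; the sum is not (see \<open>area_nonneg\<close> below).\<close>

definition area :: "nat \<Rightarrow> (nat \<Rightarrow> nat) \<Rightarrow> int" where
  "area n \<alpha> = (\<Sum>i=1..n. int n - int i - int (\<alpha> i) + 1)"

definition qvar :: "int poly" where
  "qvar = [:0, 1:]"

definition q_number :: "nat \<Rightarrow> int poly" where
  "q_number m = (\<Sum>k<m. qvar ^ k)"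

lemma park_SomeD:
  assumes "park n \<alpha> k s = Some c"
  shows "\<alpha> c \<le> s" and "s \<le> n" and "1 \<le> c" and "c \<le> k"
proof -
  have "\<alpha> c \<le> s \<and> s \<le> n \<and> 1 \<le> c \<and> c \<le> k"
    using assms
  proof (induction k arbitrary: s c)
    case (Suc k)
    define E where "E = {s \<in> {\<alpha> (Suc k)..n}. park n \<alpha> k s = None}"
    have "finite E" by (simp add: E_def)
    then have "Min E \<in> E" if "E \<noteq> {}" using that by (rule Min_in)
    then have "\<alpha> (Suc k) \<le> Min E \<and> Min E \<le> n" if "E \<noteq> {}"
      using that unfolding E_def by fastforce
    moreover have "park n \<alpha> (Suc k) =
        (if E = {} then park n \<alpha> k else (park n \<alpha> k)(Min E \<mapsto> Suc k))"
      unfolding E_def by (simp only: park.simps park_car_def Let_def)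
    ultimately show ?case
      using Suc.prems Suc.IH[of s c]
      by (auto simp del: park.simps split: if_splits)
  qed simp
  then show "\<alpha> c \<le> s" "s \<le> n" "1 \<le> c" "c \<le> k" by auto
qed

lemma parking_function_spots:
  assumes "\<alpha> \<in> parking_functions n"
  obtains f where "bij_betw f {1..n} {1..n}"
    and "\<And>c. c \<in> {1..n} \<Longrightarrow> park n \<alpha> n (f c) = Some c"
proof -
  have "\<forall>c\<in>{1..n}. \<exists>s. s \<in> {1..n} \<and> park n \<alpha> n s = Some c"
    using assms unfolding parking_functions_def by blast
  then obtain f where f: "\<And>c. c \<in> {1..n} \<Longrightarrow> f c \<in> {1..n} \<and> park n \<alpha> n (f c) = Some c"
    by metis
  have "inj_on f {1..n}"
    by (rule inj_onI) (metis f option.inject)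
  moreover from this have "f ` {1..n} = {1..n}"
    using f by (intro endo_inj_surj) auto
  ultimately show ?thesis using that f by (simp add: bij_betw_def)
qed

lemma outcome_permutes:
  assumes "\<alpha> \<in> parking_functions n"
  shows "outcome n \<alpha> permutes {1..n}"
proof -
  obtain f where f: "bij_betw f {1..n} {1..n}"
    "\<And>c. c \<in> {1..n} \<Longrightarrow> park n \<alpha> n (f c) = Some c"
    using parking_function_spots[OF assms] by blast
  have "outcome n \<alpha> (f c) = c" if "c \<in> {1..n}" for c
    using f(2)[OF that] bij_betwE[OF f(1)] that by (simp add: outcome_def)
  then have "bij_betw (outcome n \<alpha> \<circ> f) {1..n} {1..n}"
    by (simp add: bij_betw_def inj_on_def image_def)
  then have "bij_betw (outcome n \<alpha>) {1..n} {1..n}"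
    by (simp only: bij_betw_comp_iff[OF f(1), symmetric])
  then show ?thesis
    by (rule bij_imp_permutes) (auto simp: outcome_def)
qed

lemma area_nonneg:
  assumes "\<alpha> \<in> parking_functions n"
  shows "0 \<le> area n \<alpha>"
proof -
  obtain f where f: "bij_betw f {1..n} {1..n}"
    "\<And>c. c \<in> {1..n} \<Longrightarrow> park n \<alpha> n (f c) = Some c"
    using parking_function_spots[OF assms] by blast
  have "(\<Sum>i=1..n. int (\<alpha> i)) \<le> (\<Sum>i=1..n. int (f i))"
    by (rule sum_mono) (use park_SomeD(1)[OF f(2)] in simp)
  also have "\<dots> = (\<Sum>i=1..n. int i)"
    by (rule sum.reindex_bij_betw[OF f(1)])
  also have "\<dots> = (\<Sum>i=1..n. int (n + 1 - i))"
    using sum.atLeastAtMost_rev[of int 1 n] by simp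
  also have "\<dots> = (\<Sum>i=1..n. int n - int i + 1)"
    by (rule sum.cong) auto
  finally have "0 \<le> (\<Sum>i=1..n. int n - int i + 1) - (\<Sum>i=1..n. int (\<alpha> i))"
    by simp
  also have "\<dots> = area n \<alpha>"
    unfolding area_def sum_subtractf[symmetric] by (rule sum.cong) auto
  finally show ?thesis .
qed

lemma finite_fiber: "finite (fiber n \<sigma>)"
  by (rule finite_subset[of _ "{1..n} \<rightarrow>\<^sub>E {1..n}"])
     (auto simp: fiber_def parking_functions_def intro!: finite_PiE)

end

theory Submission
  imports Defs
begin

text \<open>
  If car \<open>\<sigma> i\<close> ends up in spot \<open>i\<close>, its preference \<open>a\<close> satisfies \<open>a \<le> i\<close> and all spots from \<open>a\<close>
  to \<open>i - 1\<close> were taken by earlier cars; conversely these conditions force the outcome \<open>\<sigma>\<close>. The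
  admissible preferences of car \<open>\<sigma> i\<close> are thus the last \<open>\<ell>(i;\<sigma>)\<close> spots up to \<open>i\<close>, independently for
  each car, and the area is the total displacement \<open>\<Sum>\<^sub>i (i - \<alpha> (\<sigma> i))\<close>. Hence the generating function
  factors.
\<close>

text \<open>A car takes the first empty spot from its preference on, so the spots it drives past are
  held by earlier cars, and a parked car is never moved or overwritten. Equality
  \<open>c' = c\<close> accounts for \<open>t = s\<close>.\<close>

lemma park_occupied_between:
  assumes "park n \<alpha> k s = Some c" and "t \<in> {\<alpha> c..s}"
  shows "\<exists>c'\<le>c. park n \<alpha> k t = Some c'"
  using assms
proof (induction k arbitrary: s c t)
  case (Suc k)
  define E where "E = {s \<in> {\<alpha> (Suc k)..n}. park n \<alpha> k s = None}"
  have park_Suc: "park n \<alpha> (Suc k) =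
      (if E = {} then park n \<alpha> k else (park n \<alpha> k)(Min E \<mapsto> Suc k))"
    unfolding E_def by (simp only: park.simps park_car_def Let_def)
  have fin: "finite E" by (simp add: E_def)
  have empty: "park n \<alpha> k (Min E) = None" "Min E \<le> n" if "E \<noteq> {}"
    using Min_in[OF fin that] by (auto simp: E_def)
  \<comment> \<open>Either \<open>s\<close> is the spot just taken by car \<open>Suc k\<close>, or
    it was filled before and the induction hypothesis applies; the new car only enters an empty
    spot, so it cannot disturb \<open>t\<close>.\<close>
  show ?case
  proof (cases "E \<noteq> {} \<and> s = Min E")
    case True
    then have c: "c = Suc k" using Suc.prems(1) park_Suc by simp
    show ?thesis
    proof (cases "t = s")
      case False
      then have "t < Min E" using True Suc.prems(2) by simp
      then have "t \<notin> E" using Min_le[OF fin] by fastforce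
      then obtain c' where "park n \<alpha> k t = Some c'"
        using \<open>t < Min E\<close> Suc.prems(2) c empty(2) True by (auto simp: E_def)
      with \<open>t < Min E\<close> park_SomeD(4)[OF this] c show ?thesis
        by (auto simp: park_Suc simp del: park.simps)
    qed (use Suc.prems in auto)
  next
    case False
    then have "park n \<alpha> k s = Some c"
      using Suc.prems(1) by (auto simp: park_Suc simp del: park.simps split: if_splits)
    from Suc.IH[OF this Suc.prems(2)] obtain c' where
      "c' \<le> c" "park n \<alpha> k t = Some c'" by blast
    with empty show ?thesis by (cases "E = {}") (auto simp: park_Suc simp del: park.simps)
  qed
qed simp

text \<open>These are the left ends \<open>j\<close> competing in the maximum that defines
  \<open>ell i \<sigma>\<close>, and also the admissible preferences of the car that ends in spot
  \<open>i\<close>.\<close>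

definition record_starts :: "(nat \<Rightarrow> nat) \<Rightarrow> nat \<Rightarrow> nat set" where
  "record_starts \<sigma> i = {j \<in> {1..i}. \<forall>t\<in>{j..i}. \<sigma> t \<le> \<sigma> i}"

text \<open>The condition on \<open>j\<close> passes to every larger \<open>j\<close> up to
  \<open>i\<close>, so the set is an interval ending at \<open>i\<close>, and its least element
  realizes the maximum in \<open>ell\<close>.\<close>

lemma record_starts_eq_interval:
  assumes "1 \<le> i"
  shows "ell i \<sigma> \<le> i" and "record_starts \<sigma> i = {i + 1 - ell i \<sigma>..i}"
proof -
  let ?J = "record_starts \<sigma> i"
  have fin: "finite ?J" and mem: "i \<in> ?J" using assms by (auto simp: record_starts_def)
  define m where "m = Min ?J"
  have m: "m \<in> ?J" "\<And>j. j \<in> ?J \<Longrightarrow> m \<le> j"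
    using fin mem by (auto simp: m_def intro: Min_in)
  have "{i - j + 1 | j. 1 \<le> j \<and> j \<le> i \<and> (\<forall>t\<in>{j..i}. \<sigma> t \<le> \<sigma> i)} = (\<lambda>j. i - j + 1) ` ?J"
    by (auto simp: record_starts_def)
  moreover have "Max ((\<lambda>j. i - j + 1) ` ?J) = i - m + 1"
    using m fin by (intro Max_eqI) (auto intro: diff_le_mono2)
  ultimately have ell: "ell i \<sigma> = i - m + 1" by (simp add: ell_def)
  have "1 \<le> m" "m \<le> i" using m(1) by (auto simp: record_starts_def)
  then show "ell i \<sigma> \<le> i" using ell by simp
  have "?J = {m..i}"
    using m by (auto simp: record_starts_def)
  then show "?J = {i + 1 - ell i \<sigma>..i}" using ell \<open>m \<le> i\<close> by simp
qed

lemma sum_record_starts: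
  assumes "1 \<le> i"
  shows "(\<Sum>a\<in>record_starts \<sigma> i. qvar ^ (i - a)) = q_number (ell i \<sigma>)"
  unfolding q_number_def record_starts_eq_interval(2)[OF assms]
  \<comment> \<open>The new index is the displacement \<open>i - a\<close>. The bound
    \<open>ell i \<sigma> \<le> i\<close> makes truncated subtraction invertible here.\<close>
  by (rule sum.reindex_bij_witness[where i = "\<lambda>k. i - k" and j = "\<lambda>a. i - a"])
     (use record_starts_eq_interval(1)[OF assms, of \<sigma>] in auto)

lemma park_eq_of_preferences:
  assumes \<sigma>: "\<sigma> permutes {1..n}"
    and pref: "\<And>i. i \<in> {1..n} \<Longrightarrow> \<alpha> (\<sigma> i) \<in> record_starts \<sigma> i"
    and "k \<le> n"
  shows "park n \<alpha> k = (\<lambda>s. if s \<in> {1..n} \<and> \<sigma> s \<le> k then Some (\<sigma> s) else None)"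
  using \<open>k \<le> n\<close>
proof (induction k)
  case 0
  have "\<sigma> s \<noteq> 0" if "s \<in> {1..n}" for s
    using permutes_in_image[OF \<sigma>, of s] that by auto
  then show ?case by auto
next
  case (Suc k)
  define i where "i = inv \<sigma> (Suc k)"
  have \<sigma>i: "\<sigma> i = Suc k" using permutes_inverses(1)[OF \<sigma>] by (simp add: i_def)
  have i: "i \<in> {1..n}" using permutes_in_image[OF \<sigma>, of i] \<sigma>i Suc.prems by simp
  have \<alpha>i: "1 \<le> \<alpha> (Suc k)" "\<alpha> (Suc k) \<le> i" "\<And>t. t \<in> {\<alpha> (Suc k)..i} \<Longrightarrow> \<sigma> t \<le> Suc k"
    using pref[OF i] \<sigma>i by (auto simp: record_starts_def)
  have eq_iff: "\<sigma> t = Suc k \<longleftrightarrow> t = i" for t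
    using \<sigma>i inj_eq[OF permutes_inj[OF \<sigma>], of t i] by simp
  define E where "E = {s \<in> {\<alpha> (Suc k)..n}. park n \<alpha> k s = None}"
  have park_k: "park n \<alpha> k = (\<lambda>s. if s \<in> {1..n} \<and> \<sigma> s \<le> k then Some (\<sigma> s) else None)"
    using Suc by simp
  have "i \<in> E" using i \<alpha>i(2) \<sigma>i by (simp add: E_def park_k)
  \<comment> \<open>An empty spot from the preference up to \<open>i\<close> would have
    \<sigma>-value above \<open>k\<close> but at most \<open>Suc k\<close>, and only
    \<open>i\<close> itself has the value \<open>Suc k\<close>.\<close>
  moreover have "i \<le> s" if "s \<in> E" for s
  proof (rule ccontr)
    assume "\<not> i \<le> s"
    with that \<alpha>i(1) have s: "s \<in> {\<alpha> (Suc k)..i}" "\<not> \<sigma> s \<le> k" "s \<noteq> i"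
      by (auto simp: E_def park_k split: if_splits)
    with \<alpha>i(3)[OF s(1)] eq_iff[of s] show False by linarith
  qed
  ultimately have "E \<noteq> {}" "Min E = i"
    by (auto intro!: Min_eqI simp: E_def)
  then have "park n \<alpha> (Suc k) = (park n \<alpha> k)(i \<mapsto> Suc k)"
    unfolding E_def by (simp only: park.simps park_car_def Let_def if_False)
  then show ?case
    using i by (auto simp: fun_eq_iff park_k le_Suc_eq \<sigma>i eq_iff simp del: park.simps)
qed

text \<open>The inclusion into the product comes from \<open>park_occupied_between\<close>, the
  converse from \<open>park_eq_of_preferences\<close> at \<open>k = n\<close>. The factors are
  indexed by cars, as tuples are, hence the \<open>inv \<sigma>\<close>.\<close>

lemma fiber_eq_PiE:
  assumes \<sigma>: "\<sigma> permutes {1..n}"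
  shows "fiber n \<sigma> = (\<Pi>\<^sub>E c\<in>{1..n}. record_starts \<sigma> (inv \<sigma> c))"
proof (intro equalityI subsetI)
  fix \<alpha> assume "\<alpha> \<in> fiber n \<sigma>"
  then have pf: "\<alpha> \<in> parking_functions n" and out: "outcome n \<alpha> = \<sigma>"
    by (auto simp: fiber_def)
  have \<alpha>: "\<alpha> \<in> {1..n} \<rightarrow>\<^sub>E {1..n}" using pf by (simp add: parking_functions_def)
  have "\<alpha> c \<in> record_starts \<sigma> (inv \<sigma> c)" if c: "c \<in> {1..n}" for c
  proof -
    obtain s where s: "s \<in> {1..n}" "park n \<alpha> n s = Some c"
      using pf c unfolding parking_functions_def by blast
    have \<sigma>_eq: "\<sigma> t = d" if "t \<in> {1..n}" "park n \<alpha> n t = Some d" for t d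
      using out that by (auto simp: outcome_def)
    have "inv \<sigma> c = s"
      using \<sigma>_eq[OF s] permutes_inverses(2)[OF \<sigma>] by auto
    moreover have "\<sigma> t \<le> \<sigma> s" if t: "t \<in> {\<alpha> c..s}" for t
    proof -
      have "t \<in> {1..n}" using t s(1) PiE_mem[OF \<alpha> c] by simp
      then show ?thesis
        using park_occupied_between[OF s(2) t] \<sigma>_eq \<sigma>_eq[OF s] by auto
    qed
    ultimately show ?thesis
      using park_SomeD(1)[OF s(2)] PiE_mem[OF \<alpha> c] by (simp add: record_starts_def)
  qed
  with \<alpha> show "\<alpha> \<in> (\<Pi>\<^sub>E c\<in>{1..n}. record_starts \<sigma> (inv \<sigma> c))"
    by (auto simp: PiE_iff)
next
  fix \<alpha> assume \<alpha>: "\<alpha> \<in> (\<Pi>\<^sub>E c\<in>{1..n}. record_starts \<sigma> (inv \<sigma> c))"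
  have inv_in: "inv \<sigma> c \<in> {1..n}" if "c \<in> {1..n}" for c
    using permutes_in_image[OF permutes_inv[OF \<sigma>]] that by blast
  have \<sigma>_in: "\<sigma> i \<in> {1..n}" if "i \<in> {1..n}" for i
    using permutes_in_image[OF \<sigma>] that by blast
  have "\<alpha> (\<sigma> i) \<in> record_starts \<sigma> i" if "i \<in> {1..n}" for i
    using PiE_mem[OF \<alpha> \<sigma>_in[OF that]] permutes_inverses(2)[OF \<sigma>] by simp
  from park_eq_of_preferences[OF \<sigma> this order.refl]
  have park: "park n \<alpha> n s = (if s \<in> {1..n} then Some (\<sigma> s) else None)" for s
    using \<sigma>_in by auto
  have "record_starts \<sigma> (inv \<sigma> c) \<subseteq> {1..n}" if "c \<in> {1..n}" for c
    using inv_in[OF that] by (auto simp: record_starts_def)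
  then have "\<alpha> \<in> {1..n} \<rightarrow>\<^sub>E {1..n}"
    using PiE_mono[of "{1..n}" "\<lambda>c. record_starts \<sigma> (inv \<sigma> c)" "\<lambda>_. {1..n}"] \<alpha> by blast
  moreover have "\<exists>s\<in>{1..n}. park n \<alpha> n s = Some c" if "c \<in> {1..n}" for c
    using inv_in[OF that] permutes_inverses(1)[OF \<sigma>]
    by (intro bexI[of _ "inv \<sigma> c"]) (auto simp: park)
  moreover have "outcome n \<alpha> = \<sigma>"
    using permutes_not_in[OF \<sigma>] by (auto simp: outcome_def park fun_eq_iff)
  ultimately show "\<alpha> \<in> fiber n \<sigma>"
    by (simp add: fiber_def parking_functions_def)
qed

text \<open>Both \<open>n + 1 - c\<close> and the final spot \<open>inv \<sigma> c\<close> run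
  through \<open>{1..n}\<close>, so their sums agree. The hypothesis \<open>le\<close> makes each
  natural subtraction exact.\<close>

lemma area_eq_displacement:
  assumes \<sigma>: "\<sigma> permutes {1..n}" and le: "\<And>c. c \<in> {1..n} \<Longrightarrow> \<alpha> c \<le> inv \<sigma> c"
  shows "nat (area n \<alpha>) = (\<Sum>c=1..n. inv \<sigma> c - \<alpha> c)"
proof -
  have "area n \<alpha> = (\<Sum>c=1..n. int (n + 1 - c)) - (\<Sum>c=1..n. int (\<alpha> c))"
    unfolding area_def sum_subtractf[symmetric] by (rule sum.cong) auto
  also have "(\<Sum>c=1..n. int (n + 1 - c)) = (\<Sum>c=1..n. int c)"
    using sum.atLeastAtMost_rev[of int 1 n] by simp
  also have "\<dots> = (\<Sum>c=1..n. int (inv \<sigma> c))"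
    using sum.permute[OF permutes_inv[OF \<sigma>], of int] by (simp add: comp_def)
  also have "\<dots> - (\<Sum>c=1..n. int (\<alpha> c)) = (\<Sum>c=1..n. int (inv \<sigma> c - \<alpha> c))"
    unfolding sum_subtractf[symmetric] using le by (intro sum.cong) (auto simp: of_nat_diff)
  finally show ?thesis by (simp flip: of_nat_sum)
qed

theorem proposition5p2:
  fixes n :: nat and \<sigma> :: "nat \<Rightarrow> nat"
  assumes "n \<ge> 1"
    and "\<sigma> permutes {1..n}"
  shows "(\<Sum>p\<in>fiber n \<sigma>. qvar ^ nat (area n p)) = (\<Prod>i=1..n. q_number (ell i \<sigma>))"
proof -
  let ?R = "\<lambda>c. record_starts \<sigma> (inv \<sigma> c)"
  have "qvar ^ nat (area n p) = (\<Prod>c=1..n. qvar ^ (inv \<sigma> c - p c))"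
    if p: "p \<in> (\<Pi>\<^sub>E c\<in>{1..n}. ?R c)" for p
  proof -
    have "p c \<le> inv \<sigma> c" if "c \<in> {1..n}" for c
      using PiE_mem[OF p that] by (simp add: record_starts_def)
    then show ?thesis
      using area_eq_displacement[OF assms(2)] by (simp add: power_sum)
  qed
  then have "(\<Sum>p\<in>fiber n \<sigma>. qvar ^ nat (area n p)) =
      (\<Sum>p\<in>(\<Pi>\<^sub>E c\<in>{1..n}. ?R c). \<Prod>c=1..n. qvar ^ (inv \<sigma> c - p c))"
    unfolding fiber_eq_PiE[OF assms(2)] by (intro sum.cong) auto
  \<comment> \<open>Distributivity: each car chooses its preference independently.\<close>
  also have "\<dots> = (\<Prod>c=1..n. \<Sum>a\<in>?R c. qvar ^ (inv \<sigma> c - a))"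
    by (rule prod_sum_PiE[symmetric]) (auto simp: record_starts_def)
  \<comment> \<open>The product over cars is reindexed by their final spots.\<close>
  also have "\<dots> = (\<Prod>i=1..n. \<Sum>a\<in>record_starts \<sigma> i. qvar ^ (i - a))"
    using prod.permute[OF permutes_inv[OF assms(2)],
        of "\<lambda>i. \<Sum>a\<in>record_starts \<sigma> i. qvar ^ (i - a)"] by (simp add: comp_def)
  also have "\<dots> = (\<Prod>i=1..n. q_number (ell i \<sigma>))"
    by (rule prod.cong) (auto intro: sum_record_starts)
  finally show ?thesis .
qed

end
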